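(* Let $R$ be a ring. Then $R$ is uniquely $\pi$-clean if and only if both of the following hold: (1) For any $a\in R$, there exists an $m\in\mathbb{N}$ for which there is a unique idempotent $e\in R$ such that $a^m-e\in J(R)$. (2) $J(R)=\{x\in R \mid x^m-1\in U(R)\text{ for all } m\in\mathbb{N}\}$.
   Context: All rings are associative with identity, not necessarily commutative. $\mathbb{N}$ denotes the positive integers, $J(R)$ the Jacobson radical of $R$, and $U(R)$ the group of units of $R$. An element $x$ of a ring $R$ is uniquely clean if it can be written in exactly one way as $x=e+u$ with $e\in R$ an idempotent and $u\in R$ a unit. A ring $R$ is uniquely $\pi$-clean if for every $a\in R$ there exists $n\in\mathbb{N}$ such that $a^n$ is uniquely clean. *)

theory Defs
  imports "HOL-Algebra.Algebra"
begin

definition ring_idempotents :: "('a, 'b) ring_scheme \<Rightarrow> 'a set" where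
  "ring_idempotents R = {e \<in> carrier R. e \<otimes>\<^bsub>R\<^esub> e = e}"

definition left_ideal :: "'a set \<Rightarrow> ('a, 'b) ring_scheme \<Rightarrow> bool" where
  "left_ideal I R \<longleftrightarrow>
     additive_subgroup I R \<and> (\<forall>r \<in> carrier R. \<forall>a \<in> I. r \<otimes>\<^bsub>R\<^esub> a \<in> I)"

definition maximal_left_ideal :: "'a set \<Rightarrow> ('a, 'b) ring_scheme \<Rightarrow> bool" where
  "maximal_left_ideal M R \<longleftrightarrow>
     left_ideal M R \<and> M \<noteq> carrier R \<and>
     (\<forall>I. left_ideal I R \<longrightarrow> M \<subseteq> I \<longrightarrow> I = M \<or> I = carrier R)"

text \<open>
  The library's maximal ideals are two-sided, so the Jacobson radical of a possibly noncommutative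
  ring needs the left-sided notion above. Intersecting with the carrier matters only
  for the zero ring, which has no maximal left ideal and is its own radical.
\<close>

definition jacobson_radical :: "('a, 'b) ring_scheme \<Rightarrow> 'a set" where
  "jacobson_radical R = carrier R \<inter> \<Inter>{M. maximal_left_ideal M R}"

text \<open>
  Uniqueness concerns the decomposition, i.e. the pair of an idempotent and a unit.
\<close>

definition uniquely_clean_element :: "('a, 'b) ring_scheme \<Rightarrow> 'a \<Rightarrow> bool" where
  "uniquely_clean_element R x \<longleftrightarrow>
     (\<exists>!p. p \<in> ring_idempotents R \<times> Units R \<and> x = fst p \<oplus>\<^bsub>R\<^esub> snd p)"

definition uniquely_pi_clean :: "('a, 'b) ring_scheme \<Rightarrow> bool" where
  "uniquely_pi_clean R \<longleftrightarrow>
     (\<forall>a \<in> carrier R. \<exists>n::nat. n \<ge> 1 \<and> uniquely_clean_element R (a [^]\<^bsub>R\<^esub> n))"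

end

theory Submission
  imports Defs
begin

text \<open>
  Either side of the equivalence forces idempotents to be central: compare \<open>e\<close> with the idempotent
  \<open>f = e + e r (1 - e)\<close>, for which \<open>e - (1 - f)\<close> squares to 1, and whose difference \<open>f - e\<close> squares to 0,
  so that condition (2) puts it into the radical.

  For an element \<open>x\<close> of a uniquely \<open>\<pi>\<close>-clean ring write \<open>(r x)\<^sup>k = e + w\<close>. On the corner cut out by
  \<open>h = 1 - e\<close> the element \<open>x\<close> is left invertible. If no nonzero corner has this property, then \<open>e = 1\<close>, so
  \<open>(r x)\<^sup>k - 1\<close> and hence \<open>r x - 1\<close> is left invertible for every \<open>r\<close>, that is, \<open>x\<close> lies in the radical.
  This applies to \<open>x = a - (1 - e)\<close> when \<open>a\<close> is uniquely clean with idempotent \<open>e\<close>, which yields (1),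
  and to every \<open>x\<close> as in (2). Conversely, if \<open>a - e\<close> lies in the radical, the clean decompositions of \<open>a\<close>
  are those of \<open>e\<close> up to the radical, and for central \<open>e\<close> the only one is \<open>e = (1 - e) + (2 e - 1)\<close>.
\<close>

section \<open>The Jacobson radical of a noncommutative ring\<close>

context ring
begin

text \<open>Negatives come for free: \<open>- a\<close> is the multiple of \<open>a\<close> by
  \<open>- 1\<close>, so sums, zero and left multiples suffice.\<close>

lemma left_ideal_iff:
  "left_ideal I R \<longleftrightarrow> I \<subseteq> carrier R \<and> \<zero> \<in> I \<and> (\<forall>a\<in>I. \<forall>b\<in>I. a \<oplus> b \<in> I) \<and>
     (\<forall>r\<in>carrier R. \<forall>a\<in>I. r \<otimes> a \<in> I)"
proof
  assume "left_ideal I R"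
  then show "I \<subseteq> carrier R \<and> \<zero> \<in> I \<and> (\<forall>a\<in>I. \<forall>b\<in>I. a \<oplus> b \<in> I) \<and>
     (\<forall>r\<in>carrier R. \<forall>a\<in>I. r \<otimes> a \<in> I)"
    by (auto simp: left_ideal_def additive_subgroup.a_Hcarr additive_subgroup.zero_closed
        additive_subgroup.a_closed)
next
  assume I: "I \<subseteq> carrier R \<and> \<zero> \<in> I \<and> (\<forall>a\<in>I. \<forall>b\<in>I. a \<oplus> b \<in> I) \<and>
     (\<forall>r\<in>carrier R. \<forall>a\<in>I. r \<otimes> a \<in> I)"
  have "\<ominus> a \<in> I" if "a \<in> I" for a
  proof -
    have "\<ominus> \<one> \<otimes> a = \<ominus> a" using I that by (simp add: l_minus subset_iff)
    then show ?thesis using I that by (metis a_inv_closed one_closed)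
  qed
  then have "subgroup I (add_monoid R)"
    using I by (intro subgroup.intro) (auto simp: a_inv_def[symmetric])
  then show "left_ideal I R"
    using I by (simp add: left_ideal_def additive_subgroup_def)
qed

lemma left_idealD:
  assumes "left_ideal I R"
  shows "I \<subseteq> carrier R" "\<zero> \<in> I" "\<And>a b. a \<in> I \<Longrightarrow> b \<in> I \<Longrightarrow> a \<oplus> b \<in> I"
    "\<And>r a. r \<in> carrier R \<Longrightarrow> a \<in> I \<Longrightarrow> r \<otimes> a \<in> I"
  using assms by (auto simp: left_ideal_iff)

lemma left_ideal_eq_carrier_iff:
  assumes "left_ideal I R"
  shows "I = carrier R \<longleftrightarrow> \<one> \<in> I"
  using left_idealD[OF assms] by (metis one_closed r_one subset_antisym subset_iff)

text \<open>Zorn's lemma for the left ideals above \<open>I\<close> that avoid 1. Avoiding 1 is the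
  same as being proper, and it passes to unions of chains.\<close>

lemma maximal_left_ideal_exists:
  assumes "left_ideal I R" "\<one> \<notin> I"
  shows "\<exists>M. maximal_left_ideal M R \<and> I \<subseteq> M"
proof -
  let ?A = "{K. left_ideal K R \<and> I \<subseteq> K \<and> \<one> \<notin> K}"
  have "\<exists>M\<in>?A. \<forall>L\<in>?A. M \<subseteq> L \<longrightarrow> L = M"
  proof (rule subset_Zorn_nonempty)
    show "?A \<noteq> {}" using assms by auto
  next
    fix C assume "C \<noteq> {}" and C: "subset.chain ?A C"
    then have K: "left_ideal K R \<and> I \<subseteq> K \<and> \<one> \<notin> K" if "K \<in> C" for K
      using that by (auto simp: subset_chain_def)
    \<comment> \<open>Two members of a chain are comparable, so the larger one contains both
      elements and hence their sum.\<close>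
    have "\<exists>K\<in>C. a \<in> K \<and> b \<in> K" if "a \<in> \<Union>C" "b \<in> \<Union>C" for a b
      using that C unfolding subset_chain_def by blast
    then have "\<forall>a\<in>\<Union>C. \<forall>b\<in>\<Union>C. a \<oplus> b \<in> \<Union>C"
      using left_idealD(3) K by (meson UnionI)
    moreover obtain K0 where "K0 \<in> C" using \<open>C \<noteq> {}\<close> by blast
    moreover have "\<Union>C \<subseteq> carrier R"
      using K left_idealD(1) by (meson Sup_least)
    moreover have "\<forall>r\<in>carrier R. \<forall>a\<in>\<Union>C. r \<otimes> a \<in> \<Union>C"
      using K left_idealD(4) by (meson UnionE UnionI)
    ultimately have "left_ideal (\<Union>C) R"
      unfolding left_ideal_iff using K left_idealD(2) by blast
    then show "\<Union>C \<in> ?A" using K \<open>K0 \<in> C\<close> by blast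
  qed
  then obtain M where M': "M \<in> ?A" "\<forall>L\<in>?A. M \<subseteq> L \<longrightarrow> L = M"
    by (rule bexE)
  then have M: "left_ideal M R" "I \<subseteq> M" "\<one> \<notin> M"
    by simp_all
  have max: "L = M" if "left_ideal L R" "M \<subseteq> L" "\<one> \<notin> L" for L
  proof -
    have "L \<in> ?A" using that M(2) by simp
    from M'(2)[rule_format, OF this that(2)] show ?thesis .
  qed
  have "maximal_left_ideal M R"
    unfolding maximal_left_ideal_def
    using M max left_ideal_eq_carrier_iff by blast
  with M show ?thesis by blast
qed

text \<open>This is the left ideal \<open>M + R x\<close>. It serves for a maximal \<open>M\<close>
  missing \<open>x\<close>, and with \<open>M\<close> = {0} for principal left ideals.\<close>

lemma left_ideal_add_principal:
  assumes "left_ideal M R" "x \<in> carrier R"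
  shows "left_ideal {m \<oplus> r \<otimes> x | m r. m \<in> M \<and> r \<in> carrier R} R"
proof -
  note M = left_idealD[OF assms(1)]
  let ?K = "{m \<oplus> r \<otimes> x | m r. m \<in> M \<and> r \<in> carrier R}"
  have "?K \<subseteq> carrier R" using M assms by auto
  moreover have "\<zero> \<in> ?K" using M assms by (auto intro!: exI[of _ \<zero>])
  moreover have add: "a \<oplus> b \<in> ?K" if "a \<in> ?K" "b \<in> ?K" for a b
  proof -
    from that obtain m r n s where *: "a = m \<oplus> r \<otimes> x" "b = n \<oplus> s \<otimes> x"
      "m \<in> M" "n \<in> M" "r \<in> carrier R" "s \<in> carrier R" by blast
    then have "a \<oplus> b = (m \<oplus> n) \<oplus> (r \<oplus> s) \<otimes> x"
      using M(1) assms by (simp add: subset_iff l_distr a_ac)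
    then show ?thesis using * M(3) by blast
  qed
  moreover have mult: "t \<otimes> a \<in> ?K" if "a \<in> ?K" "t \<in> carrier R" for a t
  proof -
    from that obtain m r where *: "a = m \<oplus> r \<otimes> x" "m \<in> M" "r \<in> carrier R" by blast
    then have "t \<otimes> a = t \<otimes> m \<oplus> (t \<otimes> r) \<otimes> x"
      using M(1) assms that by (simp add: subset_iff r_distr m_assoc)
    then show ?thesis using * M(4) that by blast
  qed
  ultimately show ?thesis
    unfolding left_ideal_iff by (intro conjI ballI)
qed

text \<open>Trades maximal left ideals for one-sided inverses. If \<open>1 - r x\<close> had no left
  inverse, the left ideal it generates would lie in a maximal \<open>M\<close>; so does
  \<open>r x\<close>, hence 1 would too. Conversely, if a maximal \<open>M\<close> misses
  \<open>x\<close>, then \<open>M + R x\<close> is everything, so 1 = \<open>m + r x\<close> and the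
  left invertible \<open>1 - r x\<close> lies in \<open>M\<close>.\<close>

lemma jacobson_radical_iff:
  "x \<in> jacobson_radical R \<longleftrightarrow>
     x \<in> carrier R \<and> (\<forall>r\<in>carrier R. \<exists>y\<in>carrier R. y \<otimes> (\<one> \<ominus> r \<otimes> x) = \<one>)"
proof (intro iffI conjI ballI)
  assume x: "x \<in> jacobson_radical R"
  then show xc: "x \<in> carrier R" by (simp add: jacobson_radical_def)
  fix r assume r: "r \<in> carrier R"
  let ?p = "\<one> \<ominus> r \<otimes> x"
  let ?I = "{m \<oplus> s \<otimes> ?p | m s. m \<in> {\<zero>} \<and> s \<in> carrier R}"
  have "left_ideal {\<zero>} R" by (simp add: left_ideal_iff)
  then have I: "left_ideal ?I R"
    by (rule left_ideal_add_principal) (use r xc in simp)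
  show "\<exists>y\<in>carrier R. y \<otimes> ?p = \<one>"
  proof (rule ccontr)
    assume no: "\<not> ?thesis"
    have "\<one> \<notin> ?I"
      using no r xc by auto
    then obtain M where M: "maximal_left_ideal M R" "?I \<subseteq> M"
      using maximal_left_ideal_exists[OF I] by blast
    then have lM: "left_ideal M R" by (simp add: maximal_left_ideal_def)
    have "?p = \<zero> \<oplus> \<one> \<otimes> ?p" using r xc by simp
    then have "?p \<in> ?I" by blast
    moreover have "r \<otimes> x \<in> M"
      using x M(1) r left_idealD(4)[OF lM] by (simp add: jacobson_radical_def)
    ultimately have "?p \<oplus> r \<otimes> x \<in> M" using left_idealD(3)[OF lM] M(2) by blast
    moreover have "?p \<oplus> r \<otimes> x = \<one>"
      using r xc by (simp add: minus_eq a_assoc l_neg)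
    ultimately show False
      using M(1) left_ideal_eq_carrier_iff[OF lM] by (simp add: maximal_left_ideal_def)
  qed
next
  assume x: "x \<in> carrier R \<and> (\<forall>r\<in>carrier R. \<exists>y\<in>carrier R. y \<otimes> (\<one> \<ominus> r \<otimes> x) = \<one>)"
  have "x \<in> M" if M: "maximal_left_ideal M R" for M
  proof (rule ccontr)
    assume "x \<notin> M"
    have lM: "left_ideal M R" and "M \<noteq> carrier R" using M by (auto simp: maximal_left_ideal_def)
    then have one: "\<one> \<notin> M" by (simp add: left_ideal_eq_carrier_iff)
    let ?K = "{m \<oplus> r \<otimes> x | m r. m \<in> M \<and> r \<in> carrier R}"
    note lMD = left_idealD[OF lM]
    have K: "left_ideal ?K R" using left_ideal_add_principal lM x by blast
    have "m = m \<oplus> \<zero> \<otimes> x" if "m \<in> M" for m using that lMD(1) x by auto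
    then have "M \<subseteq> ?K" by blast
    moreover have "x = \<zero> \<oplus> \<one> \<otimes> x" using x by simp
    then have "x \<in> ?K" using lMD(2) by blast
    ultimately have "?K = carrier R" using M K \<open>x \<notin> M\<close> unfolding maximal_left_ideal_def by blast
    then have "\<one> \<in> ?K" by simp
    then obtain m r where mr: "\<one> = m \<oplus> r \<otimes> x" "m \<in> M" "r \<in> carrier R" by blast
    then have "\<one> \<ominus> r \<otimes> x = m"
      using lMD(1) x by (auto simp add: minus_eq a_assoc r_neg)
    then show False using x mr lMD(4) one by metis
  qed
  then show "x \<in> jacobson_radical R" using x by (simp add: jacobson_radical_def)
qed

lemma jacobson_radical_carrier: "x \<in> jacobson_radical R \<Longrightarrow> x \<in> carrier R"
  by (simp add: jacobson_radical_def)

lemma jacobson_radical_left_mult: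
  "x \<in> jacobson_radical R \<Longrightarrow> r \<in> carrier R \<Longrightarrow> r \<otimes> x \<in> jacobson_radical R"
  unfolding jacobson_radical_iff by (metis m_assoc m_closed)

lemma jacobson_radical_minus:
  "x \<in> jacobson_radical R \<Longrightarrow> \<ominus> x \<in> jacobson_radical R"
  using jacobson_radical_left_mult[of x "\<ominus> \<one>"] by (simp add: l_minus jacobson_radical_carrier)

lemma jacobson_radical_pow:
  assumes "x \<in> jacobson_radical R" "n \<ge> (1::nat)"
  shows "x [^] n \<in> jacobson_radical R"
proof -
  have "x [^] n = x [^] (n - 1) \<otimes> x" using assms(2) by (cases n) auto
  then show ?thesis using assms by (simp add: jacobson_radical_left_mult jacobson_radical_carrier)
qed

text \<open>The left inverse \<open>y\<close> of \<open>1 - x\<close> equals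
  \<open>1 - (- y) x\<close>, so it has a left inverse \<open>z\<close> itself. Then
  \<open>z\<close> must be \<open>1 - x\<close>, and \<open>y\<close> is a two-sided
  inverse.\<close>

lemma one_minus_jacobson_radical_unit:
  assumes x: "x \<in> jacobson_radical R"
  shows "\<one> \<ominus> x \<in> Units R"
proof -
  have xc: "x \<in> carrier R" using x by (rule jacobson_radical_carrier)
  obtain y where y: "y \<in> carrier R" "y \<otimes> (\<one> \<ominus> x) = \<one>"
    using x unfolding jacobson_radical_iff by (metis l_one one_closed)
  have "y = \<one> \<oplus> y \<otimes> x"
  proof -
    have "\<one> = y \<oplus> \<ominus> (y \<otimes> x)" using y xc by (simp add: minus_eq r_distr r_minus)
    then have "\<one> \<oplus> y \<otimes> x = y \<oplus> \<ominus> (y \<otimes> x) \<oplus> y \<otimes> x" by simp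
    also have "\<dots> = y" using y(1) xc by (simp add: a_assoc l_neg)
    finally show ?thesis by simp
  qed
  then have y': "y = \<one> \<ominus> (\<ominus> y) \<otimes> x" using y xc by (simp add: minus_eq l_minus)
  obtain z where z: "z \<in> carrier R" "z \<otimes> (\<one> \<ominus> (\<ominus> y) \<otimes> x) = \<one>"
    using x y(1) unfolding jacobson_radical_iff by (meson a_inv_closed)
  have zy: "z \<otimes> y = \<one>" using z(2) y' by simp
  have "z \<otimes> (y \<otimes> (\<one> \<ominus> x)) = z" using z y by simp
  then have "z = \<one> \<ominus> x" using zy z(1) y(1) xc by (simp add: m_assoc[symmetric])
  then show ?thesis using zy y z(1) by (auto simp: Units_def)
qed

lemma Units_a_inv:
  assumes u: "u \<in> Units R"
  shows "\<ominus> u \<in> Units R"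
proof -
  have "\<ominus> \<one> \<otimes> u \<in> Units R" using u Units_minus_one_closed by simp
  then show ?thesis using u by (simp add: l_minus Units_closed)
qed

text \<open>Factor out the unit on the left: \<open>u + j = u (1 + inv u j)\<close>, where
  \<open>inv u j\<close> is again in the radical.\<close>

lemma Units_add_jacobson_radical:
  assumes u: "u \<in> Units R" and j: "j \<in> jacobson_radical R"
  shows "u \<oplus> j \<in> Units R"
proof -
  have "\<one> \<ominus> \<ominus> (inv u \<otimes> j) \<in> Units R"
    using u j by (intro one_minus_jacobson_radical_unit jacobson_radical_minus jacobson_radical_left_mult) auto
  then have "u \<otimes> (\<one> \<ominus> \<ominus> (inv u \<otimes> j)) \<in> Units R" using u by simp
  moreover have "u \<otimes> (\<one> \<ominus> \<ominus> (inv u \<otimes> j)) = u \<oplus> j"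
    using u jacobson_radical_carrier[OF j]
    by (simp add: minus_eq r_distr m_assoc[symmetric] Units_closed)
  ultimately show ?thesis by simp
qed

lemma jacobson_radical_add:
  assumes "x \<in> jacobson_radical R" "y \<in> jacobson_radical R"
  shows "x \<oplus> y \<in> jacobson_radical R"
  using assms left_idealD(3) unfolding jacobson_radical_def maximal_left_ideal_def by simp

lemma zero_jacobson_radical: "\<zero> \<in> jacobson_radical R"
  using left_idealD(2) unfolding jacobson_radical_def maximal_left_ideal_def by simp

section \<open>Idempotents and unique cleanness\<close>

lemma minus_eq_iff_eq_add:
  assumes "x \<in> carrier R" "y \<in> carrier R" "z \<in> carrier R"
  shows "x \<ominus> y = z \<longleftrightarrow> x = y \<oplus> z"
proof
  assume "x \<ominus> y = z"
  then have "y \<oplus> z = y \<oplus> (\<ominus> y \<oplus> x)" using assms by (simp add: minus_eq a_comm)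
  then show "x = y \<oplus> z" using assms by (simp add: r_neg2)
next
  assume "x = y \<oplus> z"
  then have "x \<ominus> y = \<ominus> y \<oplus> (y \<oplus> z)" using assms by (simp add: minus_eq a_comm)
  then show "x \<ominus> y = z" using assms by (simp add: r_neg1)
qed

lemma add_minus_self:
  assumes "x \<in> carrier R" "y \<in> carrier R"
  shows "y \<oplus> (x \<ominus> y) = x"
  using assms minus_eq_iff_eq_add[of x y "x \<ominus> y"] by simp

lemma idempotentD:
  assumes "e \<in> ring_idempotents R"
  shows "e \<in> carrier R" "e \<otimes> e = e"
  using assms by (auto simp: ring_idempotents_def)

lemma idempotent_complement:
  assumes e: "e \<in> ring_idempotents R"
  shows "\<one> \<ominus> e \<in> ring_idempotents R" "e \<otimes> (\<one> \<ominus> e) = \<zero>" "(\<one> \<ominus> e) \<otimes> e = \<zero>"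
    "e \<oplus> (\<one> \<ominus> e) = \<one>"
proof -
  note * = idempotentD[OF e]
  show "e \<otimes> (\<one> \<ominus> e) = \<zero>" using * by (simp add: minus_eq r_distr r_minus r_neg)
  show 1: "(\<one> \<ominus> e) \<otimes> e = \<zero>" using * by (simp add: minus_eq l_distr l_minus r_neg)
  have "(\<one> \<ominus> e) \<otimes> (\<one> \<ominus> e) = (\<one> \<ominus> e) \<oplus> \<ominus> ((\<one> \<ominus> e) \<otimes> e)"
    using *(1) by (subst (2) minus_eq) (simp add: r_distr r_minus del: minus_add)
  then have "(\<one> \<ominus> e) \<otimes> (\<one> \<ominus> e) = \<one> \<ominus> e" using 1 *(1) by simp
  then show "\<one> \<ominus> e \<in> ring_idempotents R" using *(1) by (simp add: ring_idempotents_def)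
  show "e \<oplus> (\<one> \<ominus> e) = \<one>" using * by (simp add: add_minus_self)
qed

text \<open>The idempotent determines the unit, so uniqueness of the pair reduces to uniqueness of
  its first component.\<close>

lemma uniquely_clean_iff:
  assumes x: "x \<in> carrier R"
  shows "uniquely_clean_element R x \<longleftrightarrow> (\<exists>!e. e \<in> ring_idempotents R \<and> x \<ominus> e \<in> Units R)"
proof -
  have eq: "p \<in> ring_idempotents R \<times> Units R \<and> x = fst p \<oplus> snd p \<longleftrightarrow>
      p = (fst p, x \<ominus> fst p) \<and> fst p \<in> ring_idempotents R \<and> x \<ominus> fst p \<in> Units R" for p
    using x minus_eq_iff_eq_add[of x "fst p" "snd p"] idempotentD(1)[of "fst p"]
      Units_closed[of "snd p"] add_minus_self[of x "fst p"]
    by (cases p) auto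
  show ?thesis unfolding uniquely_clean_element_def eq
  proof
    assume "\<exists>!p. p = (fst p, x \<ominus> fst p) \<and> fst p \<in> ring_idempotents R \<and> x \<ominus> fst p \<in> Units R"
    then show "\<exists>!e. e \<in> ring_idempotents R \<and> x \<ominus> e \<in> Units R"
      by (metis fst_conv)
  next
    assume "\<exists>!e. e \<in> ring_idempotents R \<and> x \<ominus> e \<in> Units R"
    then show "\<exists>!p. p = (fst p, x \<ominus> fst p) \<and> fst p \<in> ring_idempotents R \<and> x \<ominus> fst p \<in> Units R"
      by (metis fst_conv)
  qed
qed

text \<open>Here \<open>t t = t e t = 0\<close>, which makes \<open>e + t\<close> idempotent, and
  \<open>e - (1 - (e + t))\<close> squares to 1, so it is its own inverse. The case \<open>t\<close>
  = 0 says that \<open>2 e - 1\<close> is a unit.\<close>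

lemma idempotent_perturbation:
  assumes e: "e \<in> ring_idempotents R" and t: "t \<in> carrier R" "e \<otimes> t = t" "t \<otimes> e = \<zero>"
  shows "e \<oplus> t \<in> ring_idempotents R" "e \<ominus> (\<one> \<ominus> (e \<oplus> t)) \<in> Units R" "t \<otimes> t = \<zero>"
proof -
  note E = idempotentD[OF e]
  have "t \<otimes> t = t \<otimes> (e \<otimes> t)" by (simp only: t(2))
  also have "\<dots> = t \<otimes> e \<otimes> t" using E t(1) by (simp only: m_assoc)
  also have "\<dots> = \<zero>" using t by simp
  finally show tt: "t \<otimes> t = \<zero>" .
  show "e \<oplus> t \<in> ring_idempotents R"
    using E t tt by (simp add: ring_idempotents_def l_distr r_distr)
  \<comment> \<open>With this \<open>n\<close> the difference to be inverted is
    \<open>e + n + t\<close>, whose square is easy to expand.\<close>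
  define n where "n = \<ominus> (\<one> \<ominus> e)"
  note C = idempotent_complement[OF e] idempotentD[OF idempotent_complement(1)[OF e]]
  have n: "n \<in> carrier R" using C by (simp add: n_def)
  have en: "e \<otimes> n = \<zero>" "n \<otimes> e = \<zero>" using C E by (simp_all add: n_def r_minus l_minus)
  have nn: "n \<otimes> n = \<one> \<ominus> e" using C E by (simp add: n_def r_minus l_minus)
  have "n \<otimes> t = n \<otimes> (e \<otimes> t)" by (simp only: t(2))
  also have "\<dots> = n \<otimes> e \<otimes> t" using E n t(1) by (simp only: m_assoc)
  finally have nt: "n \<otimes> t = \<zero>" using en t by simp
  have tn: "t \<otimes> n = \<ominus> t" using t E by (simp add: n_def r_minus r_distr minus_eq)
  \<comment> \<open>Of the nine products only \<open>e e\<close>, \<open>e t\<close>,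
    \<open>n n\<close> and \<open>t n\<close> survive.\<close>
  have "(e \<oplus> n \<oplus> t) \<otimes> (e \<oplus> n \<oplus> t) = (e \<oplus> t) \<oplus> (\<one> \<ominus> e) \<oplus> \<ominus> t"
    using E C n t en nn nt tn tt by (simp add: l_distr r_distr a_ac)
  also have "\<dots> = (e \<oplus> (\<one> \<ominus> e)) \<oplus> (t \<oplus> \<ominus> t)"
    using E C(5) t by (simp add: a_ac)
  also have "\<dots> = \<one>" using C(4) t(1) by (simp add: r_neg)
  finally have "e \<oplus> n \<oplus> t \<in> Units R" using E n t by (auto simp: Units_def)
  moreover have "e \<ominus> (\<one> \<ominus> (e \<oplus> t)) = e \<oplus> n \<oplus> t"
    using E t by (simp add: n_def minus_eq minus_add a_assoc)
  ultimately show "e \<ominus> (\<one> \<ominus> (e \<oplus> t)) \<in> Units R" by simp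
qed

lemma corner_element:
  assumes e: "e \<in> ring_idempotents R" and r: "r \<in> carrier R"
  defines "t \<equiv> e \<otimes> r \<otimes> (\<one> \<ominus> e)"
  shows "t \<in> carrier R" "e \<otimes> t = t" "t \<otimes> e = \<zero>"
  using idempotentD[OF e] idempotent_complement[OF e] idempotentD[OF idempotent_complement(1)[OF e]] r
  by (simp_all add: t_def m_assoc) (simp_all add: m_assoc[symmetric])

text \<open>Applied to \<open>e\<close> and to its complement, the hypothesis kills both
  off-diagonal corners, so \<open>e r = e r e = r e\<close>.\<close>

lemma idempotent_central_if_corners_zero:
  assumes zero: "\<And>e r. e \<in> ring_idempotents R \<Longrightarrow> r \<in> carrier R \<Longrightarrow> e \<otimes> r \<otimes> (\<one> \<ominus> e) = \<zero>"
    and e: "e \<in> ring_idempotents R" and r: "r \<in> carrier R"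
  shows "e \<otimes> r = r \<otimes> e"
proof -
  note E = idempotentD[OF e] and C = idempotent_complement[OF e]
  note C1 = idempotentD[OF C(1)]
  have c: "\<one> \<ominus> (\<one> \<ominus> e) = e" using E by (simp add: minus_eq minus_add r_neg2)
  have "e \<otimes> r = e \<otimes> r \<otimes> (e \<oplus> (\<one> \<ominus> e))" using C(4) E r by simp
  also have "\<dots> = e \<otimes> r \<otimes> e" using zero[OF e r] E C1 r by (simp add: r_distr)
  also have "\<dots> = (e \<oplus> (\<one> \<ominus> e)) \<otimes> r \<otimes> e"
    using zero[OF C(1) r] E C1 r by (simp add: c l_distr)
  also have "\<dots> = r \<otimes> e" using C(4) E r by simp
  finally show ?thesis .
qed

text \<open>The unit \<open>1 - i\<close> annihilates \<open>i\<close>.\<close>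

lemma idempotent_jacobson_radical:
  assumes i: "i \<in> ring_idempotents R" "i \<in> jacobson_radical R"
  shows "i = \<zero>"
proof -
  have u: "\<one> \<ominus> i \<in> Units R" using i by (simp add: one_minus_jacobson_radical_unit)
  have "(\<one> \<ominus> i) \<otimes> i = (\<one> \<ominus> i) \<otimes> \<zero>"
    using idempotent_complement(3)[OF i(1)] u by (simp add: Units_closed)
  then show ?thesis using u idempotentD(1)[OF i(1)] Units_l_cancel by blast
qed

text \<open>The witness is the geometric sum. It stands on the left, so a left inverse of
  \<open>t^k - 1\<close> yields one of \<open>t - 1\<close>.\<close>

lemma pow_minus_one_factor:
  assumes t: "t \<in> carrier R"
  shows "\<exists>s\<in>carrier R. t [^] (k::nat) \<ominus> \<one> = s \<otimes> (t \<ominus> \<one>)"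
proof (induction k)
  case 0
  then show ?case using t by (auto simp: minus_eq r_neg intro!: bexI[of _ \<zero>])
next
  case (Suc k)
  then obtain s where s: "s \<in> carrier R" "t [^] k \<ominus> \<one> = s \<otimes> (t \<ominus> \<one>)" by blast
  have "(t [^] k \<oplus> s) \<otimes> (t \<ominus> \<one>) = t [^] k \<otimes> (t \<ominus> \<one>) \<oplus> (t [^] k \<ominus> \<one>)"
    using s t by (simp add: l_distr)
  also have "\<dots> = t [^] k \<otimes> t \<oplus> (\<ominus> (t [^] k) \<oplus> (t [^] k \<oplus> \<ominus> \<one>))"
    using t by (simp add: minus_eq r_distr r_minus a_assoc)
  also have "\<dots> = t [^] Suc k \<ominus> \<one>" using t by (simp add: r_neg1 minus_eq)
  finally show ?case using s t by (metis add.m_closed nat_pow_closed)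
qed

text \<open>\<open>1 - z\<close> and \<open>1 + z\<close> are mutually inverse. This is how
  condition (2) will capture elements of square zero.\<close>

lemma square_zero_minus_one_unit:
  assumes z: "z \<in> carrier R" "z \<otimes> z = \<zero>"
  shows "z \<ominus> \<one> \<in> Units R"
proof -
  have "(\<one> \<oplus> z) \<otimes> (\<one> \<ominus> z) = \<one>" "(\<one> \<ominus> z) \<otimes> (\<one> \<oplus> z) = \<one>"
    using z by (simp_all add: minus_eq l_distr r_distr l_minus r_minus a_assoc r_neg l_neg r_neg1 r_neg2)
  then have "\<one> \<ominus> z \<in> Units R" using z by (auto simp: Units_def)
  then have "\<ominus> (\<one> \<ominus> z) \<in> Units R" by (rule Units_a_inv)
  then show ?thesis using z by (simp add: minus_eq minus_add a_comm)
qed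

text \<open>The inclusion in condition (2) that holds in every ring.\<close>

lemma jacobson_radical_pow_minus_one_unit:
  assumes "x \<in> jacobson_radical R" "m \<ge> (1::nat)"
  shows "x [^] m \<ominus> \<one> \<in> Units R"
proof -
  have j: "x [^] m \<in> jacobson_radical R" using assms by (rule jacobson_radical_pow)
  then have "\<ominus> (\<one> \<ominus> x [^] m) \<in> Units R"
    by (intro Units_a_inv one_minus_jacobson_radical_unit)
  then show ?thesis using jacobson_radical_carrier[OF j] by (simp add: minus_eq minus_add a_comm)
qed

end

section \<open>Rings with central idempotents\<close>

text \<open>Known as abelian rings, although the multiplication need not commute. Both sides of the
  equivalence lead here.\<close>

locale abelian_idempotent_ring = ring +
  assumes central: "e \<in> ring_idempotents R \<Longrightarrow> r \<in> carrier R \<Longrightarrow> e \<otimes> r = r \<otimes> e"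
begin

text \<open>\<open>(1 - f) e = (1 - f) (e - f)\<close> lies in the radical and is idempotent by
  centrality, so it vanishes and \<open>e = f e\<close>. By symmetry \<open>f = e f\<close>, and the
  two products agree. This gives the uniqueness in (1).\<close>

lemma idempotents_eq_if_diff_jacobson_radical:
  assumes e: "e \<in> ring_idempotents R" and f: "f \<in> ring_idempotents R"
    and j: "e \<ominus> f \<in> jacobson_radical R"
  shows "e = f"
proof -
  have *: "e = f \<otimes> e" if e: "e \<in> ring_idempotents R" and f: "f \<in> ring_idempotents R"
    and j: "e \<ominus> f \<in> jacobson_radical R" for e f
  proof -
    note E = idempotentD[OF e] and F = idempotentD[OF f] and C = idempotent_complement[OF f]
    note C1 = idempotentD[OF C(1)]
    let ?i = "(\<one> \<ominus> f) \<otimes> e"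
    have "(\<one> \<ominus> f) \<otimes> (e \<ominus> f) = ?i"
      using E(1) F(1) C C1(1) by (subst minus_eq) (simp add: r_distr r_minus)
    then have "?i \<in> jacobson_radical R" using jacobson_radical_left_mult[OF j C1(1)] by simp
    moreover have "e \<otimes> ?i = e \<otimes> (\<one> \<ominus> f) \<otimes> e" using E C1(1) by (simp add: m_assoc)
    then have "e \<otimes> ?i = ?i" using central[OF e C1(1)] E C1(1) by (simp add: m_assoc)
    then have "?i \<otimes> ?i = (\<one> \<ominus> f) \<otimes> ?i" using E(1) C1(1) by (simp add: m_assoc)
    then have "?i \<in> ring_idempotents R"
      using E(1) C1 by (simp add: ring_idempotents_def m_assoc[symmetric])
    ultimately have "?i = \<zero>" by (simp add: idempotent_jacobson_radical)
    moreover have "e = (f \<oplus> (\<one> \<ominus> f)) \<otimes> e" using C(4) E by simp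
    then have "e = f \<otimes> e \<oplus> ?i" using E F C1(1) by (simp add: l_distr)
    ultimately show ?thesis using E F by simp
  qed
  have "f \<ominus> e \<in> jacobson_radical R"
    using jacobson_radical_minus[OF j] idempotentD(1)[OF e] idempotentD(1)[OF f]
    by (simp add: minus_eq minus_add a_comm)
  then have "f = e \<otimes> f" using * e f by blast
  also have "\<dots> = f \<otimes> e" using central e idempotentD(1)[OF f] by blast
  also have "\<dots> = e" using *[OF e f j] by simp
  finally show ?thesis by simp
qed

text \<open>Abelian rings are Dedekind finite: \<open>x y\<close> is idempotent, hence central, and
  moving it past \<open>y\<close> turns \<open>x y = x y y x\<close> into
  \<open>(y x) (y x) = 1\<close>.\<close>

lemma left_inverse_unit:
  assumes x: "x \<in> carrier R" and y: "y \<in> carrier R" and yx: "y \<otimes> x = \<one>"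
  shows "x \<in> Units R"
proof -
  have "x \<otimes> y \<otimes> (x \<otimes> y) = x \<otimes> (y \<otimes> x) \<otimes> y" using x y by (simp add: m_assoc)
  then have i: "x \<otimes> y \<in> ring_idempotents R" using x y yx by (simp add: ring_idempotents_def)
  have "x \<otimes> y = x \<otimes> y \<otimes> (y \<otimes> x)" using x y yx by simp
  also have "\<dots> = (x \<otimes> y \<otimes> y) \<otimes> x" using x y by (simp add: m_assoc)
  also have "x \<otimes> y \<otimes> y = y \<otimes> (x \<otimes> y)" using central[OF i y] by simp
  also have "y \<otimes> (x \<otimes> y) \<otimes> x = (y \<otimes> x) \<otimes> (y \<otimes> x)" using x y by (simp add: m_assoc)
  finally have "x \<otimes> y = \<one>" using yx by simp
  then show ?thesis using x y yx by (auto simp: Units_def)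
qed

section \<open>Componentwise arithmetic along a central idempotent\<close>

lemma corner_mult:
  assumes h: "h \<in> ring_idempotents R" and "a \<in> carrier R" "b \<in> carrier R" "c \<in> carrier R" "d \<in> carrier R"
  shows "(h \<otimes> a \<oplus> (\<one> \<ominus> h) \<otimes> b) \<otimes> (h \<otimes> c \<oplus> (\<one> \<ominus> h) \<otimes> d) =
    h \<otimes> (a \<otimes> c) \<oplus> (\<one> \<ominus> h) \<otimes> (b \<otimes> d)"
proof -
  note H = idempotentD[OF h] and C = idempotent_complement[OF h]
  note G = idempotentD[OF C(1)]
  \<comment> \<open>Moving the central \<open>q\<close> next to \<open>p\<close> makes the mixed
    terms multiples of \<open>h (1 - h) = 0\<close>.\<close>
  have *: "p \<otimes> x \<otimes> (q \<otimes> y) = (p \<otimes> q) \<otimes> (x \<otimes> y)"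
    if "p \<in> carrier R" "q \<in> ring_idempotents R" "x \<in> carrier R" "y \<in> carrier R" for p q x y
  proof -
    have "p \<otimes> x \<otimes> (q \<otimes> y) = p \<otimes> (x \<otimes> q) \<otimes> y"
      using that idempotentD[OF that(2)] by (simp add: m_assoc)
    also have "x \<otimes> q = q \<otimes> x" using central[OF that(2,3)] by simp
    finally show ?thesis using that idempotentD[OF that(2)] by (simp add: m_assoc)
  qed
  show ?thesis
    using assms(2-) H C G by (simp add: l_distr r_distr *[OF _ h] *[OF _ C(1)])
qed

text \<open>The inverse is glued from the two inverses in the same way; a left inverse is enough by
  \<open>left_inverse_unit\<close>.\<close>

lemma corner_Units:
  assumes h: "h \<in> ring_idempotents R" and p: "p \<in> Units R" and q: "q \<in> Units R"
  shows "h \<otimes> p \<oplus> (\<one> \<ominus> h) \<otimes> q \<in> Units R"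
proof -
  note H = idempotentD[OF h] and C = idempotent_complement[OF h]
  note G = idempotentD[OF C(1)]
  have "(h \<otimes> inv p \<oplus> (\<one> \<ominus> h) \<otimes> inv q) \<otimes> (h \<otimes> p \<oplus> (\<one> \<ominus> h) \<otimes> q) = \<one>"
    using h p q H G C by (subst corner_mult) (simp_all add: Units_closed)
  then show ?thesis
    using left_inverse_unit[of _ "h \<otimes> inv p \<oplus> (\<one> \<ominus> h) \<otimes> inv q"] p q H G by (simp add: Units_closed)
qed

text \<open>
  On the corner cut out by \<open>h\<close> both \<open>a - e\<close> and \<open>a - (1 - e)\<close> are units, so there the idempotent \<open>e\<close>
  can be exchanged for \<open>1 - e\<close>; uniqueness then forces the corner to vanish.
\<close>

lemma uniquely_clean_corner_zero:
  assumes a: "a \<in> carrier R" and uc: "uniquely_clean_element R a"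
    and e: "e \<in> ring_idempotents R" "a \<ominus> e \<in> Units R"
    and h: "h \<in> ring_idempotents R" and y: "y \<in> carrier R"
    and left: "y \<otimes> (a \<ominus> (\<one> \<ominus> e)) \<otimes> h = h"
  shows "h = \<zero>"
proof -
  define c where "c = \<one> \<ominus> e"
  define g where "g = \<one> \<ominus> h"
  define x where "x = a \<ominus> c"
  define w where "w = a \<ominus> e"
  define e' where "e' = h \<otimes> c \<oplus> g \<otimes> e"
  note E = idempotentD[OF e(1)] and EC = idempotent_complement[OF e(1), folded c_def]
  note H = idempotentD[OF h] and HG = idempotent_complement[OF h, folded g_def]
  note C = idempotentD[OF EC(1)] and G = idempotentD[OF HG(1)]
  have x: "x \<in> carrier R" using a C by (simp add: x_def)
  have w: "w \<in> Units R" using e(2) by (simp add: w_def)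
  have left': "h \<otimes> (y \<otimes> x) = h"
    using left central[OF h, of "y \<otimes> x"] y x by (simp add: x_def c_def)
  \<comment> \<open>Outside the corner \<open>x\<close> is replaced by 1, so that left invertibility
    on the corner becomes left invertibility in \<open>R\<close>.\<close>
  have "(h \<otimes> y \<oplus> g \<otimes> \<one>) \<otimes> (h \<otimes> x \<oplus> g \<otimes> \<one>) = \<one>"
    using corner_mult[OF h y one_closed x one_closed] left' HG G by (simp add: g_def[symmetric])
  then have X: "h \<otimes> x \<oplus> g \<otimes> \<one> \<in> Units R"
    by (rule left_inverse_unit[rotated 2]) (use x y H G in simp_all)
  \<comment> \<open>Only the part of this unit on the corner is kept; on the complement it is
    exchanged for the unit \<open>w\<close>.\<close>
  have "h \<otimes> (h \<otimes> x \<oplus> g \<otimes> \<one>) = h \<otimes> x"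
    using H G HG x by (simp add: r_distr m_assoc[symmetric])
  then have u: "h \<otimes> x \<oplus> g \<otimes> w \<in> Units R"
    using corner_Units[OF h X w] by (simp add: g_def[symmetric])
  have e': "e' \<in> ring_idempotents R"
    using corner_mult[OF h C(1) E(1) C(1) E(1)] H G E C
    by (simp add: ring_idempotents_def e'_def g_def[symmetric])
  have ax: "c \<oplus> x = a" and aw: "e \<oplus> w = a"
    using a C E by (simp_all add: x_def w_def add_minus_self)
  have "e' \<oplus> (h \<otimes> x \<oplus> g \<otimes> w) = h \<otimes> (c \<oplus> x) \<oplus> g \<otimes> (e \<oplus> w)"
    using H G E C x w by (simp add: e'_def r_distr a_ac Units_closed)
  also have "\<dots> = (h \<oplus> g) \<otimes> a" using ax aw H G a by (simp add: l_distr)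
  also have "\<dots> = a" using HG a by simp
  finally have "a \<ominus> e' = h \<otimes> x \<oplus> g \<otimes> w"
    using minus_eq_iff_eq_add[of a e' "h \<otimes> x \<oplus> g \<otimes> w"] a idempotentD(1)[OF e'] u
    by (simp add: Units_closed)
  then have "e' = e" using uc e e' u uniquely_clean_iff[OF a] by auto
  then have "h \<otimes> e = h \<otimes> (h \<otimes> c \<oplus> g \<otimes> e)" by (simp add: e'_def)
  also have "\<dots> = h \<otimes> c" using H G E C HG by (simp add: r_distr m_assoc[symmetric])
  finally have hc: "h \<otimes> e = h \<otimes> c" .
  \<comment> \<open>Since \<open>h e = h c\<close> and \<open>c e = 0\<close>, both summands of
    \<open>h = h e + h c\<close> vanish.\<close>
  have "h \<otimes> e = (h \<otimes> e) \<otimes> e" using H E by (simp add: m_assoc)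
  also have "\<dots> = h \<otimes> (c \<otimes> e)" using hc H E C by (simp add: m_assoc)
  also have "\<dots> = \<zero>" using EC H by simp
  finally have "h \<otimes> (e \<oplus> c) = \<zero>" using hc H E C by (simp add: r_distr)
  then show ?thesis using EC H by simp
qed

section \<open>Left invertible corners and the radical of a uniquely pi-clean ring\<close>

lemma jacobson_radical_if_no_invertible_corner:
  assumes upc: "uniquely_pi_clean R" and x: "x \<in> carrier R"
    and corner: "\<And>h y. h \<in> ring_idempotents R \<Longrightarrow> y \<in> carrier R \<Longrightarrow> y \<otimes> x \<otimes> h = h \<Longrightarrow> h = \<zero>"
  shows "x \<in> jacobson_radical R"
  unfolding jacobson_radical_iff
proof (intro conjI ballI x)
  fix r assume r: "r \<in> carrier R"
  define t where "t = r \<otimes> x"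
  have t: "t \<in> carrier R" using r x by (simp add: t_def)
  obtain n :: nat where n: "n \<ge> 1" "uniquely_clean_element R (t [^] n)"
    using upc t unfolding uniquely_pi_clean_def by blast
  then obtain e where e: "e \<in> ring_idempotents R" "t [^] n \<ominus> e \<in> Units R"
    using t uniquely_clean_iff[of "t [^] n"] by auto
  define w where "w = t [^] n \<ominus> e"
  define h where "h = \<one> \<ominus> e"
  note E = idempotentD[OF e(1)] and EC = idempotent_complement[OF e(1), folded h_def]
  note H = idempotentD[OF EC(1)]
  have w: "w \<in> Units R" using e by (simp add: w_def)
  have tn: "t [^] n = e \<oplus> w" using t E by (simp add: w_def add_minus_self)
  \<comment> \<open>As \<open>n\<close> is at least 1, a factor \<open>t = r x\<close> splits off on
    the right, exhibiting the power as a left multiple of \<open>x\<close>.\<close>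
  have "t [^] n = t [^] (n - 1) \<otimes> t" using n(1) by (cases n) auto
  then have tn': "t [^] n = t [^] (n - 1) \<otimes> r \<otimes> x" using t r x by (simp add: t_def m_assoc)
  \<comment> \<open>Since \<open>e h = 0\<close>, the power of \<open>t\<close> agrees with the unit
    \<open>w\<close> on the corner of \<open>h\<close>, so \<open>x\<close> is left invertible
    there.\<close>
  have "inv w \<otimes> (t [^] (n - 1) \<otimes> r) \<otimes> x \<otimes> h = inv w \<otimes> (t [^] n \<otimes> h)"
    using w t r x H by (simp add: tn' m_assoc)
  also have "t [^] n \<otimes> h = w \<otimes> h"
    using tn EC E H w by (simp add: l_distr Units_closed)
  also have "inv w \<otimes> (w \<otimes> h) = h" using w H by (simp add: m_assoc[symmetric] Units_closed)
  finally have "h = \<zero>" using corner[OF EC(1), of "inv w \<otimes> (t [^] (n - 1) \<otimes> r)"] w t r by simp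
  then have "e = \<one>" using EC(4) E by simp
  then have wt: "w = t [^] n \<ominus> \<one>" by (simp add: w_def)
  \<comment> \<open>With \<open>e\<close> = 1 the unit \<open>w\<close> is \<open>t^n - 1\<close>;
    factoring out \<open>t - 1\<close> turns its inverse into a left inverse of
    \<open>t - 1\<close>, and a change of sign into one of \<open>1 - t\<close>.\<close>
  obtain s where s: "s \<in> carrier R" "t [^] n \<ominus> \<one> = s \<otimes> (t \<ominus> \<one>)"
    using pow_minus_one_factor[OF t] by blast
  have "\<ominus> (inv w \<otimes> s) \<otimes> (\<one> \<ominus> t) = inv w \<otimes> s \<otimes> (\<ominus> (\<one> \<ominus> t))"
    using w s t by (simp add: l_minus r_minus)
  also have "\<ominus> (\<one> \<ominus> t) = t \<ominus> \<one>" using t by (simp add: minus_eq minus_add a_comm)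
  also have "inv w \<otimes> s \<otimes> (t \<ominus> \<one>) = inv w \<otimes> w" using w s t by (simp add: wt m_assoc)
  also have "\<dots> = \<one>" using w by simp
  finally have "\<ominus> (inv w \<otimes> s) \<otimes> (\<one> \<ominus> r \<otimes> x) = \<one>" by (simp only: t_def)
  moreover have "\<ominus> (inv w \<otimes> s) \<in> carrier R" using w s by simp
  ultimately show "\<exists>y\<in>carrier R. y \<otimes> (\<one> \<ominus> r \<otimes> x) = \<one>" by blast
qed

text \<open>Centrality of \<open>h\<close> lets the innermost \<open>y x\<close> collapse on the
  corner. This is needed because unique cleanness concerns a power of \<open>x\<close>, the corner
  \<open>x\<close> itself.\<close>

lemma corner_left_inverse_pow:
  assumes x: "x \<in> carrier R" and y: "y \<in> carrier R" and h: "h \<in> ring_idempotents R"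
    and yx: "y \<otimes> x \<otimes> h = h"
  shows "y [^] (n::nat) \<otimes> x [^] n \<otimes> h = h"
proof (induction n)
  case 0
  then show ?case using idempotentD(1)[OF h] by simp
next
  case (Suc n)
  note H = idempotentD[OF h]
  have "y [^] Suc n \<otimes> x [^] Suc n \<otimes> h = y [^] n \<otimes> (y \<otimes> x \<otimes> (x [^] n \<otimes> h))"
    unfolding nat_pow_Suc2[OF x] nat_pow_Suc[of y] using x y H by (simp add: m_assoc)
  also have "x [^] n \<otimes> h = h \<otimes> x [^] n" using central[OF h] x by simp
  also have "y \<otimes> x \<otimes> (h \<otimes> x [^] n) = y \<otimes> x \<otimes> h \<otimes> x [^] n" using x y H by (simp add: m_assoc)
  also have "\<dots> = x [^] n \<otimes> h" using yx central[OF h] x by simp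
  finally show ?case using Suc x y H by (simp add: m_assoc)
qed

text \<open>Supplies the existence in (1): the idempotent congruent to \<open>a\<close> is the
  complement of the one in its clean decomposition.\<close>

lemma uniquely_clean_diff_jacobson_radical:
  assumes upc: "uniquely_pi_clean R" and a: "a \<in> carrier R" "uniquely_clean_element R a"
    and e: "e \<in> ring_idempotents R" "a \<ominus> e \<in> Units R"
  shows "a \<ominus> (\<one> \<ominus> e) \<in> jacobson_radical R"
  using uniquely_clean_corner_zero[OF a e] a(1) idempotentD(1)[OF e(1)]
  by (intro jacobson_radical_if_no_invertible_corner upc) auto

text \<open>The other inclusion in (2). For a uniquely clean power,
  \<open>x^n = 1 + (x^n - 1)\<close> is the clean decomposition, so no nonzero corner can make
  \<open>x^n\<close>, and hence \<open>x\<close>, left invertible.\<close>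

lemma jacobson_radical_if_pow_minus_one_units:
  assumes upc: "uniquely_pi_clean R" and x: "x \<in> carrier R"
    and units: "\<And>m::nat. m \<ge> 1 \<Longrightarrow> x [^] m \<ominus> \<one> \<in> Units R"
  shows "x \<in> jacobson_radical R"
proof (rule jacobson_radical_if_no_invertible_corner[OF upc x])
  fix h y assume h: "h \<in> ring_idempotents R" and y: "y \<in> carrier R" "y \<otimes> x \<otimes> h = h"
  obtain n :: nat where n: "n \<ge> 1" "uniquely_clean_element R (x [^] n)"
    using upc x unfolding uniquely_pi_clean_def by blast
  \<comment> \<open>For the idempotent 1 the complement is 0, so
    \<open>uniquely_clean_corner_zero\<close> speaks of \<open>x^n\<close> itself.\<close>
  have "\<one> \<in> ring_idempotents R" by (simp add: ring_idempotents_def)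
  moreover have "x [^] n \<ominus> (\<one> \<ominus> \<one>) = x [^] n" using x by (simp add: minus_eq r_neg)
  ultimately show "h = \<zero>"
    using uniquely_clean_corner_zero[of "x [^] n" \<one> h "y [^] n"] n units h x y
      corner_left_inverse_pow by simp
qed

lemma uniquely_clean_if_diff_jacobson_radical:
  assumes a: "a \<in> carrier R" and e: "e \<in> ring_idempotents R" "a \<ominus> e \<in> jacobson_radical R"
  shows "uniquely_clean_element R a"
  unfolding uniquely_clean_iff[OF a]
proof (rule ex1I[of _ "\<one> \<ominus> e"], intro conjI)
  define c where "c = \<one> \<ominus> e"
  define j where "j = a \<ominus> e"
  note E = idempotentD[OF e(1)] and EC = idempotent_complement[OF e(1), folded c_def]
  note C = idempotentD[OF EC(1)]
  have j: "j \<in> jacobson_radical R" using e by (simp add: j_def)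
  note jc = jacobson_radical_carrier[OF j]
  have aj: "a = e \<oplus> j" using a E by (simp add: j_def add_minus_self)
  show "\<one> \<ominus> e \<in> ring_idempotents R" using EC by (simp add: c_def)
  \<comment> \<open>This is the unit \<open>2 e - 1\<close>; adding \<open>j\<close> keeps it a unit
    and gives \<open>a - c\<close>.\<close>
  have "e \<ominus> c \<in> Units R"
    using idempotent_perturbation(2)[OF e(1), of \<zero>] E by (simp add: c_def)
  then have "e \<ominus> c \<oplus> j \<in> Units R" using j by (rule Units_add_jacobson_radical)
  moreover have "e \<ominus> c \<oplus> j = a \<ominus> c" using E C jc by (simp add: aj minus_eq a_ac)
  ultimately show "a \<ominus> (\<one> \<ominus> e) \<in> Units R" by (simp add: c_def)
  fix f assume "f \<in> ring_idempotents R \<and> a \<ominus> f \<in> Units R"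
  then have f: "f \<in> ring_idempotents R" "a \<ominus> f \<in> Units R" by auto
  define d where "d = \<one> \<ominus> f"
  note F = idempotentD[OF f(1)] and FD = idempotent_complement[OF f(1), folded d_def]
  note D = idempotentD[OF FD(1)]
  have "a \<ominus> f \<oplus> \<ominus> j \<in> Units R"
    using f j by (intro Units_add_jacobson_radical jacobson_radical_minus)
  moreover have "a \<ominus> f \<oplus> \<ominus> j = e \<ominus> f \<oplus> (j \<oplus> \<ominus> j)"
    using E F jc by (simp add: aj minus_eq a_ac)
  ultimately have u: "e \<ominus> f \<in> Units R" using jc E F by (simp add: r_neg)
  \<comment> \<open>The unit \<open>e - f\<close> annihilates any \<open>z\<close> on which
    \<open>e\<close> and \<open>f\<close> act alike. This applies to \<open>e f\<close> and to
    \<open>c d\<close>, which forces \<open>f\<close> to be the complement of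
    \<open>e\<close>.\<close>
  have cancel: "z = \<zero>" if "z \<in> carrier R" "e \<otimes> z = f \<otimes> z" for z
  proof -
    have "(e \<ominus> f) \<otimes> z = (e \<ominus> f) \<otimes> \<zero>"
      using that E F by (simp add: minus_eq l_distr l_minus r_neg)
    then show ?thesis using u that(1) Units_l_cancel by blast
  qed
  have "e \<otimes> (e \<otimes> f) = f \<otimes> (e \<otimes> f)"
    using E F central[OF e(1) F(1)] by (simp add: m_assoc[symmetric]) (simp add: m_assoc)
  then have ef: "e \<otimes> f = \<zero>" using cancel E F by simp
  have "f \<otimes> (c \<otimes> d) = c \<otimes> (f \<otimes> d)"
    using central[OF f(1) C(1)] F C D by (simp add: m_assoc[symmetric])
  moreover have "e \<otimes> (c \<otimes> d) = \<zero>" using EC E C D by (simp add: m_assoc[symmetric])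
  ultimately have cd: "c \<otimes> d = \<zero>" using cancel[of "c \<otimes> d"] FD C D by simp
  have "f = (e \<oplus> c) \<otimes> f" using EC F by simp
  also have "\<dots> = c \<otimes> f \<oplus> c \<otimes> d" using ef cd E C F by (simp add: l_distr)
  also have "\<dots> = c \<otimes> (f \<oplus> d)" using C F D by (simp add: r_distr)
  also have "\<dots> = c" using FD C by simp
  finally show "f = \<one> \<ominus> e" by (simp add: c_def)
qed

end

section \<open>Centrality of idempotents from either side of the equivalence\<close>

context ring
begin

lemma idempotent_nat_pow:
  assumes "e \<in> ring_idempotents R" "n \<ge> (1::nat)"
  shows "e [^] n = e"
  using assms(2)
proof (induction n rule: dec_induct)
  case base
  then show ?case using idempotentD[OF assms(1)] by simp
next
  case (step n)
  then show ?case using idempotentD[OF assms(1)] by simp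
qed

text \<open>An idempotent equals its powers, so \<open>e\<close> is itself uniquely clean. Both
  \<open>1 - e\<close> and \<open>1 - (e + t)\<close> occur in clean decompositions of
  \<open>e\<close>, so the corner element \<open>t\<close> vanishes.\<close>

lemma abelian_if_uniquely_pi_clean:
  assumes upc: "uniquely_pi_clean R"
  shows "abelian_idempotent_ring R"
proof (intro abelian_idempotent_ring.intro abelian_idempotent_ring_axioms.intro ring_axioms
    idempotent_central_if_corners_zero)
  fix e r assume e: "e \<in> ring_idempotents R" and r: "r \<in> carrier R"
  note E = idempotentD[OF e]
  define t where "t = e \<otimes> r \<otimes> (\<one> \<ominus> e)"
  note t = corner_element[OF e r, folded t_def]
  note P = idempotent_perturbation[OF e t] and Q = idempotent_perturbation[OF e, of \<zero>]
  obtain n :: nat where "n \<ge> 1" "uniquely_clean_element R (e [^] n)"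
    using upc E unfolding uniquely_pi_clean_def by blast
  then have "uniquely_clean_element R e" using idempotent_nat_pow[OF e] by simp
  moreover have "\<one> \<ominus> e \<in> ring_idempotents R" "e \<ominus> (\<one> \<ominus> e) \<in> Units R"
    using idempotent_complement[OF e] Q E by simp_all
  moreover have "\<one> \<ominus> (e \<oplus> t) \<in> ring_idempotents R" "e \<ominus> (\<one> \<ominus> (e \<oplus> t)) \<in> Units R"
    using idempotent_complement P by simp_all
  ultimately have "\<one> \<ominus> (e \<oplus> t) = \<one> \<ominus> e"
    using uniquely_clean_iff[OF E(1)] by auto
  then have "\<ominus> (e \<oplus> t) = \<ominus> e" using E t(1) by (simp add: minus_eq)
  then have "e \<oplus> t = e" using E t(1) by (metis minus_minus add.m_closed)
  then show "e \<otimes> r \<otimes> (\<one> \<ominus> e) = \<zero>" using E t(1) by (simp add: t_def)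
qed

text \<open>The corner element \<open>t\<close> has square zero, so (2) puts it into the radical.
  Then \<open>e\<close> and \<open>e + t\<close> are idempotents congruent to \<open>e\<close>, and
  the uniqueness in (1) gives \<open>t\<close> = 0.\<close>

lemma abelian_if_unique_idempotent_mod_jacobson_radical:
  assumes ex1: "\<And>a. a \<in> carrier R \<Longrightarrow> \<exists>m::nat. m \<ge> 1 \<and>
       (\<exists>!e. e \<in> ring_idempotents R \<and> a [^] m \<ominus> e \<in> jacobson_radical R)"
    and J: "jacobson_radical R = {x \<in> carrier R. \<forall>m::nat. m \<ge> 1 \<longrightarrow> x [^] m \<ominus> \<one> \<in> Units R}"
  shows "abelian_idempotent_ring R"
proof (intro abelian_idempotent_ring.intro abelian_idempotent_ring_axioms.intro ring_axioms
    idempotent_central_if_corners_zero)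
  fix e r assume e: "e \<in> ring_idempotents R" and r: "r \<in> carrier R"
  note E = idempotentD[OF e]
  define t where "t = e \<otimes> r \<otimes> (\<one> \<ominus> e)"
  note t = corner_element[OF e r, folded t_def]
  note P = idempotent_perturbation[OF e t]
  have "t [^] m \<ominus> \<one> \<in> Units R" if m: "m \<ge> 1" for m :: nat
  proof (rule square_zero_minus_one_unit)
    obtain k where k: "m = Suc k" using m by (cases m) auto
    \<comment> \<open>Since \<open>m\<close> is at least 1, the square of the power contains
      \<open>t t\<close> in the middle.\<close>
    have "t [^] m \<otimes> t [^] m = (t [^] k \<otimes> t) \<otimes> (t \<otimes> t [^] k)"
      using t(1) k nat_pow_Suc2[OF t(1)] by simp
    also have "\<dots> = t [^] k \<otimes> (t \<otimes> t) \<otimes> t [^] k" using t(1) by (simp add: m_assoc)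
    finally show "t [^] m \<otimes> t [^] m = \<zero>" using P(3) t(1) by simp
  qed (use t in simp)
  then have tJ: "t \<in> jacobson_radical R" using t(1) J by simp
  obtain m :: nat where m: "m \<ge> 1"
    "\<exists>!f. f \<in> ring_idempotents R \<and> e [^] m \<ominus> f \<in> jacobson_radical R"
    using ex1[OF E(1)] by blast
  moreover have "e \<ominus> (e \<oplus> t) = \<ominus> t" using E t(1) by (simp add: minus_eq minus_add r_neg2)
  then have "e \<ominus> (e \<oplus> t) \<in> jacobson_radical R" using tJ by (simp add: jacobson_radical_minus)
  moreover have "e \<ominus> e \<in> jacobson_radical R" using E by (simp add: minus_eq r_neg zero_jacobson_radical)
  ultimately have "e \<oplus> t = e" using e P(1) idempotent_nat_pow[OF e m(1)] by auto
  then show "e \<otimes> r \<otimes> (\<one> \<ominus> e) = \<zero>" using E t(1) by (simp add: t_def)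
qed

end

section \<open>The two directions of the equivalence\<close>

theorem theorem2p10:
  fixes R :: "('a, 'b) ring_scheme" (structure)
  assumes "ring R"
  shows "uniquely_pi_clean R \<longleftrightarrow>
    (\<forall>a \<in> carrier R. \<exists>m::nat. m \<ge> 1 \<and>
       (\<exists>!e. e \<in> ring_idempotents R \<and> a [^] m \<ominus> e \<in> jacobson_radical R)) \<and>
    jacobson_radical R = {x \<in> carrier R. \<forall>m::nat. m \<ge> 1 \<longrightarrow> x [^] m \<ominus> \<one> \<in> Units R}"
  (is "_ \<longleftrightarrow> ?one \<and> ?two")
proof
  interpret ring R by fact
  assume upc: "uniquely_pi_clean R"
  then interpret abelian_idempotent_ring R by (rule abelian_if_uniquely_pi_clean)
  have ?one
  proof
    fix a assume a: "a \<in> carrier R"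
    obtain n :: nat where n: "n \<ge> 1" "uniquely_clean_element R (a [^] n)"
      using upc a unfolding uniquely_pi_clean_def by blast
    define b where "b = a [^] n"
    have b: "b \<in> carrier R" "uniquely_clean_element R b" using n a by (simp_all add: b_def)
    then obtain e where e: "e \<in> ring_idempotents R" "b \<ominus> e \<in> Units R"
      using uniquely_clean_iff[of b] by auto
    define c where "c = \<one> \<ominus> e"
    have c: "c \<in> ring_idempotents R" using idempotent_complement[OF e(1)] by (simp add: c_def)
    note C = idempotentD[OF c]
    have bc: "b \<ominus> c \<in> jacobson_radical R"
      using uniquely_clean_diff_jacobson_radical[OF upc b e] by (simp add: c_def)
    have "f = c" if f: "f \<in> ring_idempotents R" "b \<ominus> f \<in> jacobson_radical R" for f
    proof (rule idempotents_eq_if_diff_jacobson_radical[OF f(1) c])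
      note F = idempotentD[OF f(1)]
      \<comment> \<open>Two idempotents congruent to \<open>b\<close> are congruent to each other:
        \<open>b\<close> cancels in the difference.\<close>
      have "(b \<ominus> c) \<oplus> \<ominus> (b \<ominus> f) \<in> jacobson_radical R"
        using bc f by (intro jacobson_radical_add jacobson_radical_minus)
      moreover have "(b \<ominus> c) \<oplus> \<ominus> (b \<ominus> f) = (f \<ominus> c) \<oplus> (b \<oplus> \<ominus> b)"
        using b C F by (simp add: minus_eq minus_add a_ac)
      ultimately show "f \<ominus> c \<in> jacobson_radical R" using b C F by (simp add: r_neg)
    qed
    then have "\<exists>!f. f \<in> ring_idempotents R \<and> b \<ominus> f \<in> jacobson_radical R"
      using c bc by blast
    then show "\<exists>m::nat. m \<ge> 1 \<and>
        (\<exists>!e. e \<in> ring_idempotents R \<and> a [^] m \<ominus> e \<in> jacobson_radical R)"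
      using n(1) unfolding b_def by blast
  qed
  moreover have ?two
    using jacobson_radical_pow_minus_one_unit jacobson_radical_carrier
      jacobson_radical_if_pow_minus_one_units[OF upc] by blast
  ultimately show "?one \<and> ?two" by blast
next
  interpret ring R by fact
  assume "?one \<and> ?two"
  then have one: ?one and two: ?two by blast+
  interpret abelian_idempotent_ring R
    using one two by (intro abelian_if_unique_idempotent_mod_jacobson_radical) blast+
  \<comment> \<open>The exponent that (1) provides for \<open>a\<close> also makes its power
    uniquely clean.\<close>
  show "uniquely_pi_clean R"
    unfolding uniquely_pi_clean_def
    using one uniquely_clean_if_diff_jacobson_radical nat_pow_closed by meson
qed

end
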